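(* Let $(X,\mathcal A,m)$ and $(\Omega,\mathcal F,\mathbb P)$ be probability spaces, let $\sigma:\Omega\to\Omega$ be a $\mathbb P$-preserving transformation, and let $(P,\sigma)$ be a Markov operator cocycle derived from non-singular transformations $T_\omega:X\to X$, that is, each $P_\omega$ is the Perron–Frobenius operator associated to $T_\omega$. Then $(P,\sigma)$ is exact if and only if for $\mathbb P$-almost every $\omega\in\Omega$, $$\bigcap_{n\ge 1}\bigl(T^{(n)}_\omega\bigr)^{-1}\mathcal A=\{\emptyset,X\}\pmod m.$$
   Context: The Perron–Frobenius operator $L_T$ of a non-singular map $T$ ($T_*m\ll m$) is characterized by $\int_X L_Tf\cdot g\,dm=\int_X f\cdot g\circ T\,dm$ for $f\in L^1(X,m)$, $g\in L^\infty(X,m)$. A Markov operator cocycle $(P,\sigma)$ is given by a measurable map $P:\Omega\times L^1(X,m)\to L^1(X,m)$ such that $P_\omega=P(\omega,\cdot)$ is a linear positive integral-preserving operator for $\mathbb P$-almost every $\omega$. Set $P^{(n)}_\omega=P_{\sigma^{n-1}\omega}\circ\cdots\circ P_{\sigma\omega}\circ P_\omega$ and $T^{(n)}_\omega=T_{\sigma^{n-1}\omega}\circ\cdots\circ T_{\sigma\omega}\circ T_\omega$. $(T^{(n)}_\omega)^{-1}\mathcal A=\{(T^{(n)}_\omega)^{-1}A:A\in\mathcal A\}$. Equality with $\{\emptyset,X\}$ mod $m$ is understood modulo $m$-null sets, i.e. the intersection of these $\sigma$-algebras is trivial up to $m$-null sets. $(P,\sigma)$ is exact if for $\mathbb P$-almost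 every $\omega$ and every $f\in L^1(X,m)$ with $\int_X f\,dm=0$, $\lim_{n\to\infty}\|P^{(n)}_\omega f\|_{L^1(X)}=0$. *)

theory Defs
  imports "HOL-Probability.Probability"
begin

text \<open>
  Elements of \<open>L\<^sup>1(X, m)\<close> are represented by integrable real functions, identified when equal
  \<open>m\<close>-almost everywhere. Accordingly, an operator on \<open>L\<^sup>1\<close> is a map on functions that sends
  integrable functions to integrable functions and respects almost-everywhere equality; its
  algebraic properties are required almost everywhere.
\<close>

definition L1_norm :: "'a measure \<Rightarrow> ('a \<Rightarrow> real) \<Rightarrow> real" where
  "L1_norm m f = (LINT x|m. \<bar>f x\<bar>)"

text \<open>
  The Borel \<open>\<sigma>\<close>-algebra of the \<open>L\<^sup>1\<close> norm. Every norm-open set of representatives is saturated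
  under almost-everywhere equality, so measurability with respect to this \<open>\<sigma>\<close>-algebra is the same
  as measurability with respect to the Borel \<open>\<sigma>\<close>-algebra of the quotient space.
\<close>

definition L1_open :: "'a measure \<Rightarrow> ('a \<Rightarrow> real) set \<Rightarrow> bool" where
  "L1_open m U \<longleftrightarrow> U \<subseteq> {f. integrable m f} \<and>
     (\<forall>f\<in>U. \<exists>e>0. \<forall>g. integrable m g \<and> L1_norm m (\<lambda>x. g x - f x) < e \<longrightarrow> g \<in> U)"

definition L1_borel :: "'a measure \<Rightarrow> ('a \<Rightarrow> real) measure" where
  "L1_borel m = sigma {f. integrable m f} {U. L1_open m U}"

definition L1_operator :: "'a measure \<Rightarrow> (('a \<Rightarrow> real) \<Rightarrow> 'a \<Rightarrow> real) \<Rightarrow> bool" where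
  "L1_operator m Q \<longleftrightarrow>
     (\<forall>f. integrable m f \<longrightarrow> integrable m (Q f)) \<and>
     (\<forall>f g. integrable m f \<and> integrable m g \<and> (AE x in m. f x = g x)
        \<longrightarrow> (AE x in m. Q f x = Q g x))"

definition markov_operator :: "'a measure \<Rightarrow> (('a \<Rightarrow> real) \<Rightarrow> 'a \<Rightarrow> real) \<Rightarrow> bool" where
  "markov_operator m Q \<longleftrightarrow>
     L1_operator m Q \<and>
     (\<forall>a b f g. integrable m f \<and> integrable m g
        \<longrightarrow> (AE x in m. Q (\<lambda>y. a * f y + b * g y) x = a * Q f x + b * Q g x)) \<and>
     (\<forall>f. integrable m f \<and> (AE x in m. 0 \<le> f x) \<longrightarrow> (AE x in m. 0 \<le> Q f x)) \<and>
     (\<forall>f. integrable m f \<longrightarrow> (LINT x|m. Q f x) = (LINT x|m. f x))"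

definition measure_preserving_map :: "'w measure \<Rightarrow> ('w \<Rightarrow> 'w) \<Rightarrow> bool" where
  "measure_preserving_map \<Omega> \<sigma> \<longleftrightarrow> \<sigma> \<in> \<Omega> \<rightarrow>\<^sub>M \<Omega> \<and> distr \<Omega> \<Omega> \<sigma> = \<Omega>"

definition markov_operator_cocycle ::
  "'a measure \<Rightarrow> 'w measure \<Rightarrow> ('w \<Rightarrow> ('a \<Rightarrow> real) \<Rightarrow> 'a \<Rightarrow> real) \<Rightarrow> ('w \<Rightarrow> 'w) \<Rightarrow> bool" where
  "markov_operator_cocycle m \<Omega> P \<sigma> \<longleftrightarrow>
     measure_preserving_map \<Omega> \<sigma> \<and>
     (\<lambda>(\<omega>, f). P \<omega> f) \<in> \<Omega> \<Otimes>\<^sub>M L1_borel m \<rightarrow>\<^sub>M L1_borel m \<and>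
     (AE \<omega> in \<Omega>. markov_operator m (P \<omega>))"

text \<open>
  \<open>F\<^sup>(\<^sup>n\<^sup>)\<^sub>\<omega> = F\<^bsub>\<sigma>\<^sup>n\<^sup>-\<^sup>1\<omega>\<^esub> \<circ> \<dots> \<circ> F\<^bsub>\<sigma>\<omega>\<^esub> \<circ> F\<^sub>\<omega>\<close>, used both for the operators \<open>P\<close> and for the maps \<open>T\<close>.
\<close>

primrec cocycle_iter :: "('w \<Rightarrow> 'w) \<Rightarrow> ('w \<Rightarrow> 'b \<Rightarrow> 'b) \<Rightarrow> nat \<Rightarrow> 'w \<Rightarrow> 'b \<Rightarrow> 'b" where
  "cocycle_iter \<sigma> F 0 \<omega> = id"
| "cocycle_iter \<sigma> F (Suc n) \<omega> = F ((\<sigma> ^^ n) \<omega>) \<circ> cocycle_iter \<sigma> F n \<omega>"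

definition exact_cocycle ::
  "'a measure \<Rightarrow> 'w measure \<Rightarrow> ('w \<Rightarrow> ('a \<Rightarrow> real) \<Rightarrow> 'a \<Rightarrow> real) \<Rightarrow> ('w \<Rightarrow> 'w) \<Rightarrow> bool" where
  "exact_cocycle m \<Omega> P \<sigma> \<longleftrightarrow>
     (AE \<omega> in \<Omega>. \<forall>f. integrable m f \<and> (LINT x|m. f x) = 0
        \<longrightarrow> (\<lambda>n. L1_norm m (cocycle_iter \<sigma> P n \<omega> f)) \<longlonglongrightarrow> 0)"

definition nonsingular_map :: "'a measure \<Rightarrow> ('a \<Rightarrow> 'a) \<Rightarrow> bool" where
  "nonsingular_map m T \<longleftrightarrow> T \<in> m \<rightarrow>\<^sub>M m \<and> absolutely_continuous m (distr m m T)"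

definition perron_frobenius_operator ::
  "'a measure \<Rightarrow> ('a \<Rightarrow> 'a) \<Rightarrow> (('a \<Rightarrow> real) \<Rightarrow> 'a \<Rightarrow> real) \<Rightarrow> bool" where
  "perron_frobenius_operator m T Q \<longleftrightarrow>
     L1_operator m Q \<and>
     (\<forall>f g. integrable m f \<and> g \<in> borel_measurable m \<and> (\<exists>C. AE x in m. \<bar>g x\<bar> \<le> C)
        \<longrightarrow> (LINT x|m. Q f x * g x) = (LINT x|m. f x * g (T x)))"

definition preimage_sets :: "'a measure \<Rightarrow> ('a \<Rightarrow> 'a) \<Rightarrow> 'a set set" where
  "preimage_sets m T = {T -` A \<inter> space m | A. A \<in> sets m}"

text \<open>Two families of sets agree mod \<open>m\<close> when each member of either family differs from some
  member of the other by an \<open>m\<close>-null set.\<close>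

definition eq_mod_null :: "'a measure \<Rightarrow> 'a set set \<Rightarrow> 'a set set \<Rightarrow> bool" where
  "eq_mod_null m \<C> \<D> \<longleftrightarrow>
     (\<forall>A\<in>\<C>. \<exists>B\<in>\<D>. sym_diff A B \<in> null_sets m) \<and>
     (\<forall>B\<in>\<D>. \<exists>A\<in>\<C>. sym_diff A B \<in> null_sets m)"

end

theory Submission
  imports Defs
begin

text \<open>
  Fix \<open>\<omega>\<close> and let \<open>\<F>\<^sub>n\<close> be the preimage of the \<open>\<sigma>\<close>-algebra of \<open>m\<close> under \<open>T\<^sup>(\<^sup>n\<^sup>)\<^sub>\<omega>\<close>, a decreasing
  sequence. If \<open>E = (T\<^sup>(\<^sup>n\<^sup>)\<^sub>\<omega>)\<^sup>-\<^sup>1 A\<^sub>n\<close> for all \<open>n\<close>, then testing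
  \<open>P\<^sup>(\<^sup>n\<^sup>)\<^sub>\<omega> (1\<^sub>E - m E)\<close> against the indicator of \<open>A\<^sub>n\<close> yields \<open>m E (1 - m E)\<close> for all \<open>n\<close>,
  so exactness forces \<open>m E \<in> {0, 1}\<close>. Conversely, testing \<open>P\<^sup>(\<^sup>n\<^sup>)\<^sub>\<omega> f\<close> against its sign shows that
  its norm is at most that of the conditional expectation of \<open>f\<close> given \<open>\<F>\<^sub>n\<close>. For bounded \<open>f\<close> these
  conditional expectations are projections of \<open>f\<close> to decreasing subspaces of \<open>L\<^sup>2\<close>, hence form a
  Cauchy sequence, whose limit is measurable with respect to the trivial tail \<open>\<sigma>\<close>-algebra; general
  \<open>f\<close> follows by truncation.
\<close>

section \<open>Elementary estimates on probability spaces\<close>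

text \<open>This is nonnegativity of the variance of \<open>\<bar>X x\<bar>\<close>; it turns
  \<open>L^2\<close> estimates into \<open>L^1\<close> estimates.\<close>

lemma (in prob_space) expectation_abs_square_le:
  fixes X :: "'a \<Rightarrow> real"
  assumes "integrable M X" "integrable M (\<lambda>x. (X x)\<^sup>2)"
  shows "(expectation (\<lambda>x. \<bar>X x\<bar>))\<^sup>2 \<le> expectation (\<lambda>x. (X x)\<^sup>2)"
  using variance_eq[of "\<lambda>x. \<bar>X x\<bar>"] variance_positive[of "\<lambda>x. \<bar>X x\<bar>"] assms by simp

text \<open>Triviality of the single event \<open>0 < h x\<close> already gives \<open>h\<close> a
  constant sign almost everywhere, and such a function with zero integral vanishes almost
  everywhere.\<close>

lemma (in prob_space) AE_eq_0_if_prob_pos_trivial: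
  fixes h :: "'a \<Rightarrow> real"
  assumes h: "integrable M h" "expectation h = 0"
    and triv: "prob {x \<in> space M. 0 < h x} = 0 \<or> prob {x \<in> space M. 0 < h x} = 1"
  shows "AE x in M. h x = 0"
proof -
  have [measurable]: "h \<in> borel_measurable M" using h(1) by auto
  from triv show ?thesis
  proof
    assume "prob {x \<in> space M. 0 < h x} = 0"
    then have "AE x in M. \<not> 0 < h x"
      by (subst (asm) prob_eq_0) auto
    then have "AE x in M. 0 \<le> - h x" by (auto simp: not_less)
    moreover have "expectation (\<lambda>x. - h x) = 0" using h(2) by simp
    ultimately show ?thesis
      using integral_nonneg_eq_0_iff_AE[of M "\<lambda>x. - h x"] h(1) by simp
  next
    assume "prob {x \<in> space M. 0 < h x} = 1"
    then have "AE x in M. 0 < h x"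
      by (subst (asm) prob_eq_1) auto
    then have "AE x in M. 0 \<le> h x" by (auto intro: less_imp_le)
    then show ?thesis
      using integral_nonneg_eq_0_iff_AE[of M h] h by simp
  qed
qed

lemma integrable_mult_bounded:
  fixes f g :: "'a \<Rightarrow> real"
  assumes "integrable M f" "g \<in> borel_measurable M" "AE x in M. \<bar>g x\<bar> \<le> C"
  shows "integrable M (\<lambda>x. f x * g x)"
proof (rule Bochner_Integration.integrable_bound[of _ "\<lambda>x. C * f x"])
  show "integrable M (\<lambda>x. C * f x)" using assms(1) by simp
  show "(\<lambda>x. f x * g x) \<in> borel_measurable M" using assms by simp
  show "AE x in M. norm (f x * g x) \<le> norm (C * f x)"
    using assms(3)
  proof eventually_elim
    case (elim x)
    then have "\<bar>g x\<bar> \<le> \<bar>C\<bar>" by linarith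
    then have "\<bar>g x\<bar> * \<bar>f x\<bar> \<le> \<bar>C\<bar> * \<bar>f x\<bar>" by (rule mult_right_mono) simp
    then show ?case by (simp add: abs_mult mult.commute)
  qed
qed

section \<open>Conditional expectations in \<open>L^1\<close>\<close>

text \<open>Since \<open>h\<close> is measurable for \<open>F\<close>, pairing with it does not
  distinguish \<open>f\<close> from its conditional expectation. It will be applied to a sign
  function composed with \<open>S n\<close>.\<close>

lemma (in sigma_finite_subalgebra) integral_mult_le_cond_exp:
  fixes f h :: "'a \<Rightarrow> real"
  assumes f: "integrable M f" and h: "h \<in> borel_measurable F" "\<And>x. \<bar>h x\<bar> \<le> 1"
  shows "(\<integral>x. f x * h x \<partial>M) \<le> (\<integral>x. \<bar>real_cond_exp M F f x\<bar> \<partial>M)"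
proof -
  have hM: "h \<in> borel_measurable M" by (rule measurable_from_subalg[OF subalg h(1)])
  have int: "integrable M (\<lambda>x. h x * f x)"
    using integrable_mult_bounded[OF f hM, of 1] h(2) by (simp add: mult.commute)
  have "(\<integral>x. f x * h x \<partial>M) = (\<integral>x. h x * real_cond_exp M F f x \<partial>M)"
    using real_cond_exp_intg(2)[OF int h(1)] f by (simp add: mult.commute)
  also have "\<dots> \<le> (\<integral>x. \<bar>real_cond_exp M F f x\<bar> \<partial>M)"
  proof (rule integral_mono)
    show "integrable M (\<lambda>x. h x * real_cond_exp M F f x)"
      using real_cond_exp_intg(1)[OF int h(1)] f by simp
    show "integrable M (\<lambda>x. \<bar>real_cond_exp M F f x\<bar>)"
      using real_cond_exp_int(1)[OF f] by simp
    show "h x * real_cond_exp M F f x \<le> \<bar>real_cond_exp M F f x\<bar>" for x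
      using mult_right_mono[OF h(2)[of x], of "\<bar>real_cond_exp M F f x\<bar>"]
      by (simp add: abs_mult[symmetric])
  qed
  finally show ?thesis .
qed

text \<open>The \<open>L^1\<close> norm of the conditional expectation is its pairing with its own
  sign; that sign is measurable for \<open>F\<close>, so the pairing can be moved back to
  \<open>f\<close>.\<close>

lemma (in sigma_finite_subalgebra) integral_abs_real_cond_exp_le:
  fixes f :: "'a \<Rightarrow> real"
  assumes f: "integrable M f"
  shows "(\<integral>x. \<bar>real_cond_exp M F f x\<bar> \<partial>M) \<le> (\<integral>x. \<bar>f x\<bar> \<partial>M)"
proof -
  let ?h = "\<lambda>x. sgn (real_cond_exp M F f x)"
  have hF: "?h \<in> borel_measurable F" by simp
  have hM: "?h \<in> borel_measurable M" by (rule measurable_from_subalg[OF subalg hF])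
  have b: "\<bar>?h x\<bar> \<le> 1" for x by (simp add: sgn_real_def)
  have int: "integrable M (\<lambda>x. f x * ?h x)"
    using integrable_mult_bounded[OF f hM, of 1] b by simp
  have "(\<integral>x. \<bar>real_cond_exp M F f x\<bar> \<partial>M) = (\<integral>x. ?h x * real_cond_exp M F f x \<partial>M)"
    by (simp add: abs_sgn mult.commute)
  also have "\<dots> = (\<integral>x. ?h x * f x \<partial>M)"
    using real_cond_exp_intg(2)[OF _ hF, of f] int f by (simp add: mult.commute)
  also have "\<dots> \<le> (\<integral>x. \<bar>f x\<bar> \<partial>M)"
  proof (rule integral_mono)
    show "?h x * f x \<le> \<bar>f x\<bar>" for x
      by (auto simp: sgn_real_def)
  qed (use int f in \<open>simp_all add: mult.commute\<close>)
  finally show ?thesis .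
qed

section \<open>Convergence of reverse martingales with trivial tail\<close>

text \<open>The squared \<open>L^2\<close> norms \<open>a n\<close> decrease to some
  \<open>l\<close>. An almost everywhere convergent subsequence of the conditional expectations has
  limit 0, which identifies \<open>l\<close> as 0 and so controls the whole sequence.\<close>

lemma (in prob_space) reverse_martingale_bounded:
  fixes F :: "nat \<Rightarrow> 'a measure" and f :: "'a \<Rightarrow> real"
  assumes sub: "\<And>n. subalgebra M (F n)"
    and decr: "\<And>n k. n \<le> k \<Longrightarrow> sets (F k) \<subseteq> sets (F n)"
    and triv: "\<And>A. (\<And>n. A \<in> sets (F n)) \<Longrightarrow> prob A = 0 \<or> prob A = 1"
    and f: "f \<in> borel_measurable M" "\<And>x. \<bar>f x\<bar> \<le> C" "expectation f = 0"
  shows "(\<lambda>n. expectation (\<lambda>x. \<bar>real_cond_exp M (F n) f x\<bar>)) \<longlonglongrightarrow> 0"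
proof -
  have int_f: "integrable M f"
    using f by (intro integrable_const_bound[of _ C]) auto
  define u where "u n = real_cond_exp M (F n) f" for n
  have sf: "sigma_finite_subalgebra M (F n)" for n
    by (intro finite_measure_subalgebra_is_sigma_finite finite_measure_subalgebra.intro
        finite_measure_axioms finite_measure_subalgebra_axioms.intro sub)
  have uF: "u n \<in> borel_measurable (F n)" for n
    by (simp add: u_def)
  have spF: "space (F n) = space M" for n using sub by (auto simp: subalgebra_def)
  have uFk: "u k \<in> borel_measurable (F n)" if "n \<le> k" for n k
    using measurable_mono[of borel borel "F k" "F n"] decr[OF that] uF[of k] spF by auto
  have uM [measurable]: "u n \<in> borel_measurable M" for n
    by (rule measurable_from_subalg[OF sub uF])
  have bdd: "AE x in M. \<bar>u n x\<bar> \<le> C" for n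
  proof -
    interpret sigma_finite_subalgebra M "F n" by (rule sf)
    have "AE x in M. - C \<le> u n x" "AE x in M. u n x \<le> C"
      unfolding u_def using f(2)
      by (auto intro!: real_cond_exp_ge_c real_cond_exp_le_c int_f simp: abs_le_iff minus_le_iff)
    then show ?thesis by eventually_elim auto
  qed
  have int_u: "integrable M (u n)" for n
    using bdd by (intro integrable_const_bound[of _ C]) auto
  have int_uu: "integrable M (\<lambda>x. u n x * u k x)" for n k
    by (rule integrable_mult_bounded[OF int_u uM bdd])
  have int_uf: "integrable M (\<lambda>x. u k x * f x)" for k
    using f by (intro integrable_mult_bounded[OF int_u, where C = C]) auto
  \<comment> \<open>For \<open>n \<le> k\<close> the function \<open>u k\<close> is measurable for
    \<open>F n\<close>. The right-hand side is free of \<open>n\<close>, so the inner product of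
    \<open>u k\<close> and \<open>u n\<close> equals that of \<open>u k\<close> with itself.\<close>
  have proj: "expectation (\<lambda>x. u k x * u n x) = expectation (\<lambda>x. u k x * f x)"
    if "n \<le> k" for n k
  proof -
    interpret sigma_finite_subalgebra M "F n" by (rule sf)
    show ?thesis
      unfolding u_def[of n] by (rule real_cond_exp_intg(2)[OF int_uf uFk[OF that] f(1)])
  qed
  define a where "a n = expectation (\<lambda>x. (u n x)\<^sup>2)" for n
  have pyth: "expectation (\<lambda>x. (u n x - u k x)\<^sup>2) = a n - a k" if "n \<le> k" for n k
  proof -
    have "expectation (\<lambda>x. (u n x - u k x)\<^sup>2)
        = expectation (\<lambda>x. u n x * u n x - 2 * (u k x * u n x) + u k x * u k x)"
      by (simp add: power2_eq_square algebra_simps)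
    also have "\<dots> = expectation (\<lambda>x. u n x * u n x) - 2 * expectation (\<lambda>x. u k x * u n x)
        + expectation (\<lambda>x. u k x * u k x)"
      by (simp add: int_uu)
    also have "\<dots> = a n - a k"
      using proj[OF that] proj[of k k] by (simp add: a_def power2_eq_square)
    finally show ?thesis .
  qed
  have a_decr: "a k \<le> a n" if "n \<le> k" for n k
  proof -
    have "0 \<le> expectation (\<lambda>x. (u n x - u k x)\<^sup>2)" by simp
    then show ?thesis using pyth[OF that] by simp
  qed
  have "decseq a" using a_decr by (simp add: decseq_def)
  moreover have "0 \<le> a n" for n by (simp add: a_def)
  ultimately obtain l where l: "a \<longlonglongrightarrow> l" using decseq_convergent[of a 0] by blast
  then have "Cauchy a" by (rule LIMSEQ_imp_Cauchy)
  have int_sq: "integrable M (\<lambda>x. (u n x - u k x)\<^sup>2)" for n k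
    using int_uu[of n n] int_uu[of n k] int_uu[of k k]
    by (simp add: power2_diff mult.assoc) (simp add: power2_eq_square)
  have L1_le: "(expectation (\<lambda>x. \<bar>u n x - u k x\<bar>))\<^sup>2 \<le> \<bar>a n - a k\<bar>" for n k
  proof -
    have "(expectation (\<lambda>x. \<bar>u n x - u k x\<bar>))\<^sup>2 \<le> expectation (\<lambda>x. (u n x - u k x)\<^sup>2)"
      using int_u int_sq by (intro expectation_abs_square_le) auto
    also have "\<dots> = \<bar>a n - a k\<bar>"
    proof (cases "n \<le> k")
      case True
      then show ?thesis using pyth[OF True] a_decr[OF True] by simp
    next
      case False
      then have "k \<le> n" by simp
      then show ?thesis using pyth[of k n] a_decr[of k n] by (simp add: power2_commute)
    qed
    finally show ?thesis .
  qed
  have "\<exists>N. \<forall>i\<ge>N. \<forall>j\<ge>N. expectation (\<lambda>x. norm (u i x - u j x)) < e" if "e > 0" for e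
  proof -
    \<comment> \<open>The tolerance is \<open>e\<^sup>2\<close> because \<open>L1_le\<close> bounds
      the square of the \<open>L^1\<close> distance.\<close>
    obtain N where N: "\<And>i j. i \<ge> N \<Longrightarrow> j \<ge> N \<Longrightarrow> \<bar>a i - a j\<bar> < e\<^sup>2"
      using CauchyD[OF \<open>Cauchy a\<close>, of "e\<^sup>2"] \<open>e > 0\<close> by auto
    have "expectation (\<lambda>x. norm (u i x - u j x)) < e" if "i \<ge> N" "j \<ge> N" for i j
    proof (rule power2_less_imp_less)
      show "(expectation (\<lambda>x. norm (u i x - u j x)))\<^sup>2 < e\<^sup>2"
        using L1_le[of i j] N[OF that] by simp
    qed (use \<open>e > 0\<close> in simp)
    then show ?thesis by blast
  qed
  then obtain r where r: "strict_mono r" "AE x in M. Cauchy (\<lambda>i. u (r i) x)"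
    using cauchy_L1_AE_cauchy_subseq[of M u] int_u by blast
  define h where "h x = lim (\<lambda>i. u (r i) x)" for x
  \<comment> \<open>A shifted sequence has exactly the same limits, so \<open>lim\<close> agrees
    even at points of divergence, where it is an unspecified value. The identity thus holds
    everywhere, and \<open>h\<close> itself, not just a version of it, is measurable for every
    \<open>F k\<close>.\<close>
  have h_shift: "h x = lim (\<lambda>i. u (r (i + k)) x)" for x k
  proof -
    have "(\<lambda>i. u (r (i + k)) x) \<longlonglongrightarrow> L \<longleftrightarrow> (\<lambda>i. u (r i) x) \<longlonglongrightarrow> L" for L
      using LIMSEQ_ignore_initial_segment[of "\<lambda>i. u (r i) x" L k]
        LIMSEQ_offset[of "\<lambda>i. u (r i) x" k L] by blast
    then show ?thesis by (simp add: h_def lim_def)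
  qed
  have hF: "h \<in> borel_measurable (F k)" for k
  proof -
    have "k \<le> r (i + k)" for i
      using seq_suble[OF r(1), of "i + k"] by linarith
    then have "(\<lambda>x. lim (\<lambda>i. u (r (i + k)) x)) \<in> borel_measurable (F k)"
      by (intro borel_measurable_lim_metric uFk)
    moreover have "h = (\<lambda>x. lim (\<lambda>i. u (r (i + k)) x))"
      by (rule ext) (rule h_shift)
    ultimately show ?thesis by (simp only:)
  qed
  have hM [measurable]: "h \<in> borel_measurable M"
    by (rule measurable_from_subalg[OF sub hF[of 0]])
  have lim_h: "AE x in M. (\<lambda>i. u (r i) x) \<longlonglongrightarrow> h x"
    using r(2) by eventually_elim (simp add: h_def Cauchy_convergent_iff convergent_LIMSEQ_iff)
  have h_int: "integrable M h" and h_lim: "(\<lambda>i. expectation (u (r i))) \<longlonglongrightarrow> expectation h"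
  proof -
    have *: "AE x in M. norm (u (r i) x) \<le> C" for i using bdd by simp
    show "integrable M h"
      by (rule integrable_dominated_convergence[OF hM uM _ lim_h *]) simp
    show "(\<lambda>i. expectation (u (r i))) \<longlonglongrightarrow> expectation h"
      by (rule integral_dominated_convergence[OF hM uM _ lim_h *]) simp
  qed
  have "expectation (u n) = 0" for n
  proof -
    interpret sigma_finite_subalgebra M "F n" by (rule sf)
    show ?thesis unfolding u_def using real_cond_exp_int(2)[OF int_f] f(3) by simp
  qed
  then have "expectation h = 0" using h_lim by (simp add: LIMSEQ_const_iff)
  moreover have "{x \<in> space M. 0 < h x} \<in> sets (F k)" for k
    using borel_measurable_less[OF borel_measurable_const hF[of k], of 0] spF by simp
  ultimately have h0: "AE x in M. h x = 0"
    using triv by (intro AE_eq_0_if_prob_pos_trivial h_int) auto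
  \<comment> \<open>The bound \<open>C\<close> makes dominated convergence available for the
    squares, so the \<open>L^2\<close> norms along the subsequence tend to 0.\<close>
  have "(\<lambda>i. a (r i)) \<longlonglongrightarrow> expectation (\<lambda>x. 0 :: real)"
    unfolding a_def
  proof (rule integral_dominated_convergence[where w = "\<lambda>_. C\<^sup>2"])
    show "AE x in M. (\<lambda>i. (u (r i) x)\<^sup>2) \<longlonglongrightarrow> 0"
      using lim_h h0
    proof eventually_elim
      case (elim x)
      then show ?case using tendsto_power[of "\<lambda>i. u (r i) x" 0 sequentially 2] by simp
    qed
    show "AE x in M. norm ((u (r i) x)\<^sup>2) \<le> C\<^sup>2" for i
      using bdd[of "r i"] by eventually_elim (simp add: abs_le_square_iff[symmetric])
  qed simp_all
  moreover have "(\<lambda>i. a (r i)) \<longlonglongrightarrow> l"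
    using LIMSEQ_subseq_LIMSEQ[OF l r(1)] by (simp add: o_def)
  ultimately have "l = 0" using LIMSEQ_unique by fastforce
  have "(\<lambda>n. sqrt (a n)) \<longlonglongrightarrow> 0"
    using tendsto_real_sqrt[OF l] \<open>l = 0\<close> by simp
  then show ?thesis
  proof (rule Lim_null_comparison[rotated], intro always_eventually allI)
    fix n
    have "(expectation (\<lambda>x. \<bar>u n x\<bar>))\<^sup>2 \<le> a n"
      unfolding a_def
      using int_u int_uu by (intro expectation_abs_square_le) (auto simp: power2_eq_square)
    then show "norm (expectation (\<lambda>x. \<bar>real_cond_exp M (F n) f x\<bar>)) \<le> sqrt (a n)"
      by (simp add: u_def real_le_rsqrt)
  qed
qed

text \<open>Conditional expectation contracts the \<open>L^1\<close> norm, so it suffices to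
  approximate \<open>f\<close> in \<open>L^1\<close> by a bounded function of mean zero.\<close>

lemma (in prob_space) reverse_martingale_L1:
  fixes F :: "nat \<Rightarrow> 'a measure" and f :: "'a \<Rightarrow> real"
  assumes sub: "\<And>n. subalgebra M (F n)"
    and decr: "\<And>n k. n \<le> k \<Longrightarrow> sets (F k) \<subseteq> sets (F n)"
    and triv: "\<And>A. (\<And>n. A \<in> sets (F n)) \<Longrightarrow> prob A = 0 \<or> prob A = 1"
    and f: "integrable M f" "expectation f = 0"
  shows "(\<lambda>n. expectation (\<lambda>x. \<bar>real_cond_exp M (F n) f x\<bar>)) \<longlonglongrightarrow> 0"
proof (rule LIMSEQ_I)
  fix e :: real assume "e > 0"
  have fM [measurable]: "f \<in> borel_measurable M" using f by auto
  define t where "t N x = max (- real N) (min (real N) (f x))" for N :: nat and x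
  have [measurable]: "t N \<in> borel_measurable M" for N unfolding t_def by measurable
  have t_f: "\<bar>t N x - f x\<bar> \<le> \<bar>f x\<bar>" for N x by (auto simp: t_def)
  have int_t: "integrable M (t N)" for N
    by (intro integrable_const_bound[of _ "real N"]) (auto simp: t_def)
  have "(\<lambda>N. expectation (\<lambda>x. \<bar>t N x - f x\<bar>)) \<longlonglongrightarrow> expectation (\<lambda>x. 0 :: real)"
  proof (rule integral_dominated_convergence[where w = "\<lambda>x. \<bar>f x\<bar>"])
    show "AE x in M. (\<lambda>N. \<bar>t N x - f x\<bar>) \<longlonglongrightarrow> 0"
    proof (rule AE_I2)
      fix x
      \<comment> \<open>Once the truncation level passes \<open>\<bar>f x\<bar>\<close>, truncation
        no longer changes the value.\<close>
      obtain K :: nat where K: "\<bar>f x\<bar> \<le> real K" using real_arch_simple by blast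
      have "t N x = f x" if "N \<ge> K" for N
        using K that by (simp add: t_def)
      then have "eventually (\<lambda>N. \<bar>t N x - f x\<bar> = 0) sequentially"
        by (auto simp: eventually_sequentially)
      then show "(\<lambda>N. \<bar>t N x - f x\<bar>) \<longlonglongrightarrow> 0" by (rule tendsto_eventually)
    qed
  qed (use t_f f in auto)
  then have "eventually (\<lambda>N. expectation (\<lambda>x. \<bar>t N x - f x\<bar>) < e / 3) sequentially"
    using \<open>e > 0\<close> by (intro order_tendstoD(2)) auto
  then obtain N where N: "expectation (\<lambda>x. \<bar>t N x - f x\<bar>) < e / 3"
    by (auto simp: eventually_sequentially)
  \<comment> \<open>Truncation may destroy the zero mean; subtracting \<open>c\<close> restores
    it.\<close>
  define c where "c = expectation (t N)"
  define g where "g x = t N x - c" for x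
  \<comment> \<open>As \<open>f\<close> has mean zero, \<open>c\<close> is also the mean of the
    truncation error and costs at most another \<open>e / 3\<close>.\<close>
  have "c = expectation (\<lambda>x. t N x - f x)" using f int_t by (simp add: c_def)
  then have c: "\<bar>c\<bar> < e / 3"
    using integral_abs_bound[of M "\<lambda>x. t N x - f x"] N by linarith
  have gM [measurable]: "g \<in> borel_measurable M" unfolding g_def by measurable
  have int_g: "integrable M g" unfolding g_def using int_t by simp
  have g_bdd: "\<bar>g x\<bar> \<le> real N + \<bar>c\<bar>" for x
    by (auto simp: g_def t_def)
  have g0: "expectation g = 0"
    unfolding g_def using int_t by (simp add: c_def prob_space)
  have fg: "expectation (\<lambda>x. \<bar>f x - g x\<bar>) < 2 * e / 3"
  proof -
    have "expectation (\<lambda>x. \<bar>f x - g x\<bar>) \<le> expectation (\<lambda>x. \<bar>t N x - f x\<bar> + \<bar>c\<bar>)"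
      using int_g int_t f by (intro integral_mono) (auto simp: g_def)
    also have "\<dots> = expectation (\<lambda>x. \<bar>t N x - f x\<bar>) + \<bar>c\<bar>"
      using int_t f by (simp add: prob_space)
    finally show ?thesis using N c by simp
  qed
  have "(\<lambda>n. expectation (\<lambda>x. \<bar>real_cond_exp M (F n) g x\<bar>)) \<longlonglongrightarrow> 0"
    by (rule reverse_martingale_bounded[OF sub decr triv gM g_bdd g0])
  then have "eventually (\<lambda>n. expectation (\<lambda>x. \<bar>real_cond_exp M (F n) g x\<bar>) < e / 3) sequentially"
    using \<open>e > 0\<close> by (intro order_tendstoD(2)) auto
  then obtain n0 where n0: "\<And>n. n \<ge> n0 \<Longrightarrow> expectation (\<lambda>x. \<bar>real_cond_exp M (F n) g x\<bar>) < e / 3"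
    by (auto simp: eventually_sequentially)
  have "norm (expectation (\<lambda>x. \<bar>real_cond_exp M (F n) f x\<bar>) - 0) < e" if "n \<ge> n0" for n
  proof -
    interpret sigma_finite_subalgebra M "F n"
      by (intro finite_measure_subalgebra_is_sigma_finite finite_measure_subalgebra.intro
          finite_measure_axioms finite_measure_subalgebra_axioms.intro sub)
    let ?E = "real_cond_exp M (F n)"
    have int: "integrable M (?E f)" "integrable M (?E g)" "integrable M (?E (\<lambda>x. f x - g x))"
      using f int_g by (auto intro!: real_cond_exp_int)
    have "AE x in M. ?E (\<lambda>x. f x - g x) x = ?E f x - ?E g x"
      using f int_g by (intro real_cond_exp_diff) auto
    then have "AE x in M. \<bar>?E f x\<bar> \<le> \<bar>?E g x\<bar> + \<bar>?E (\<lambda>x. f x - g x) x\<bar>"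
      by eventually_elim auto
    then have "expectation (\<lambda>x. \<bar>?E f x\<bar>)
        \<le> expectation (\<lambda>x. \<bar>?E g x\<bar> + \<bar>?E (\<lambda>x. f x - g x) x\<bar>)"
      using int by (intro integral_mono_AE) auto
    also have "\<dots> = expectation (\<lambda>x. \<bar>?E g x\<bar>) + expectation (\<lambda>x. \<bar>?E (\<lambda>x. f x - g x) x\<bar>)"
      using int by simp
    also have "expectation (\<lambda>x. \<bar>?E (\<lambda>x. f x - g x) x\<bar>) \<le> expectation (\<lambda>x. \<bar>f x - g x\<bar>)"
      using f int_g by (intro integral_abs_real_cond_exp_le) auto
    finally show ?thesis using n0[OF that] fg by simp
  qed
  then show "\<exists>n0. \<forall>n\<ge>n0. norm (expectation (\<lambda>x. \<bar>real_cond_exp M (F n) f x\<bar>) - 0) < e"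
    by blast
qed

section \<open>Perron-Frobenius operators of composed maps\<close>

lemma perron_frobenius_operator_id: "perron_frobenius_operator m id id"
  by (simp add: perron_frobenius_operator_def L1_operator_def)

lemma perron_frobenius_operatorD:
  assumes "perron_frobenius_operator m S Q" "integrable m f"
  shows "integrable m (Q f)"
    and "g \<in> borel_measurable m \<Longrightarrow> AE x in m. \<bar>g x\<bar> \<le> C
      \<Longrightarrow> (LINT x|m. Q f x * g x) = (LINT x|m. f x * g (S x))"
  using assms unfolding perron_frobenius_operator_def L1_operator_def by blast+

text \<open>The test function passes first through \<open>Q'\<close>, then through \<open>Q\<close>.
  Non-singularity of \<open>S'\<close> carries the almost everywhere bound on \<open>g\<close> over
  to \<open>g\<close> composed with \<open>S'\<close>, which is therefore an admissible test
  function for \<open>Q\<close>.\<close>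

lemma perron_frobenius_operator_comp:
  assumes "perron_frobenius_operator m S Q" "perron_frobenius_operator m S' Q'"
    and S': "nonsingular_map m S'"
  shows "perron_frobenius_operator m (S' \<circ> S) (Q' \<circ> Q)"
proof -
  have meas: "S' \<in> m \<rightarrow>\<^sub>M m" and ac: "absolutely_continuous m (distr m m S')"
    using S' by (auto simp: nonsingular_map_def)
  have "(LINT x|m. Q' (Q f) x * g x) = (LINT x|m. f x * g (S' (S x)))"
    if f: "integrable m f" and g: "g \<in> borel_measurable m" "AE x in m. \<bar>g x\<bar> \<le> C" for f g C
  proof -
    have "AE x in distr m m S'. \<bar>g x\<bar> \<le> C"
      using absolutely_continuous_AE[OF _ ac g(2)] by simp
    then have "AE x in m. \<bar>g (S' x)\<bar> \<le> C" using meas by (rule AE_distrD[rotated])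
    moreover have "(\<lambda>x. g (S' x)) \<in> borel_measurable m" using meas g(1) by simp
    moreover have "integrable m (Q f)" by (rule perron_frobenius_operatorD(1)[OF assms(1) f])
    ultimately show ?thesis
      using perron_frobenius_operatorD(2)[OF assms(2), of "Q f" g C]
        perron_frobenius_operatorD(2)[OF assms(1) f, of "\<lambda>x. g (S' x)" C] g by simp
  qed
  moreover have "L1_operator m (Q' \<circ> Q)"
    using assms(1,2) by (simp add: perron_frobenius_operator_def L1_operator_def)
  ultimately show ?thesis
    unfolding perron_frobenius_operator_def by auto
qed

lemma cocycle_iter_perron_frobenius:
  assumes "\<And>k. nonsingular_map m (T ((\<sigma> ^^ k) \<omega>))"
    and "\<And>k. perron_frobenius_operator m (T ((\<sigma> ^^ k) \<omega>)) (P ((\<sigma> ^^ k) \<omega>))"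
  shows "perron_frobenius_operator m (cocycle_iter \<sigma> T n \<omega>) (cocycle_iter \<sigma> P n \<omega>)"
  by (induction n) (simp_all only: cocycle_iter.simps perron_frobenius_operator_id
      perron_frobenius_operator_comp assms)

lemma cocycle_iter_measurable:
  assumes "\<And>k. T ((\<sigma> ^^ k) \<omega>) \<in> m \<rightarrow>\<^sub>M m"
  shows "cocycle_iter \<sigma> T n \<omega> \<in> m \<rightarrow>\<^sub>M m"
  by (induction n) (simp_all only: cocycle_iter.simps id_def measurable_comp[OF _ assms]
      measurable_ident_sets)

section \<open>Preimage families and triviality modulo null sets\<close>

text \<open>Pulling back along \<open>S'\<close> first yields a measurable set that \<open>S\<close>
  then pulls back. This makes the preimage families of the cocycle decrease.\<close>

lemma preimage_sets_comp_subset: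
  assumes "S \<in> m \<rightarrow>\<^sub>M m" "S' \<in> m \<rightarrow>\<^sub>M m"
  shows "preimage_sets m (S' \<circ> S) \<subseteq> preimage_sets m S"
proof
  fix E assume "E \<in> preimage_sets m (S' \<circ> S)"
  then obtain A where A: "A \<in> sets m" "E = (S' \<circ> S) -` A \<inter> space m"
    by (auto simp: preimage_sets_def)
  then have "E = S -` (S' -` A \<inter> space m) \<inter> space m"
    using measurable_space[OF assms(1)] by auto
  then show "E \<in> preimage_sets m S"
    using measurable_sets[OF assms(2) A(1)] unfolding preimage_sets_def by blast
qed

lemma sets_vimage_algebra_eq_preimage_sets:
  assumes "S \<in> m \<rightarrow>\<^sub>M m"
  shows "sets (vimage_algebra (space m) S m) = preimage_sets m S"
  using measurable_space[OF assms] by (subst sets_vimage_algebra2) (auto simp: preimage_sets_def)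

text \<open>Differing from \<open>{}\<close> by a null set means probability 0, and differing from
  \<open>space M\<close> by one means probability 1. In the other direction, \<open>{}\<close> and
  \<open>space M\<close> are their own witnesses in \<open>\<C>\<close>.\<close>

lemma (in prob_space) eq_mod_null_trivial_iff:
  assumes "\<C> \<subseteq> sets M" "{} \<in> \<C>" "space M \<in> \<C>"
  shows "eq_mod_null M \<C> {{}, space M} \<longleftrightarrow> (\<forall>A\<in>\<C>. prob A = 0 \<or> prob A = 1)"
proof -
  have "(\<exists>B\<in>{{}, space M}. sym_diff A B \<in> null_sets M) \<longleftrightarrow> prob A = 0 \<or> prob A = 1"
    if "A \<in> \<C>" for A
  proof -
    have A: "A \<in> sets M" using that assms by auto
    have "sym_diff A (space M) = space M - A" using sets.sets_into_space[OF A] by auto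
    then have "sym_diff A (space M) \<in> null_sets M \<longleftrightarrow> prob A = 1"
      using A prob_compl[OF A] by (auto simp: null_sets_def emeasure_eq_measure)
    moreover have "sym_diff A {} \<in> null_sets M \<longleftrightarrow> prob A = 0"
      using A by (auto simp: null_sets_def emeasure_eq_measure)
    ultimately show ?thesis by auto
  qed
  moreover have "\<exists>A\<in>\<C>. sym_diff A B \<in> null_sets M" if "B \<in> {{}, space M}" for B
    using that assms by (intro bexI[of _ B]) auto
  ultimately show ?thesis unfolding eq_mod_null_def by blast
qed

section \<open>Decay of the operators and triviality of the tail, for a fixed sequence of
  maps\<close>

lemma (in prob_space) prob_trivial_if_perron_frobenius_tendsto_0:
  assumes Q: "\<And>n. perron_frobenius_operator M (S n) (Q n)"
    and lim: "\<And>f. integrable M f \<Longrightarrow> expectation f = 0 \<Longrightarrow> (\<lambda>n. L1_norm M (Q n f)) \<longlonglongrightarrow> 0"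
    and E: "E \<in> sets M" "\<And>n. n \<ge> 1 \<Longrightarrow> E \<in> preimage_sets M (S n)"
  shows "prob E = 0 \<or> prob E = 1"
proof -
  define f where "f x = indicator E x - prob E" for x
  have indE: "integrable M (indicat_real E)"
    using E(1) by (simp add: less_top[symmetric])
  then have int: "integrable M f" unfolding f_def by simp
  have f0: "expectation f = 0"
    unfolding f_def using indE E(1) by (simp add: prob_space)
  have le: "prob E * (1 - prob E) \<le> L1_norm M (Q n f)" if n: "n \<ge> 1" for n
  proof -
    obtain A where A: "A \<in> sets M" "E = S n -` A \<inter> space M"
      using E(2)[OF n] by (auto simp: preimage_sets_def)
    have Qf: "integrable M (Q n f)"
      by (rule perron_frobenius_operatorD(1)[OF Q int])
    have "prob E * (1 - prob E) = expectation (\<lambda>x. (1 - prob E) * indicator E x)"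
      using E(1) by simp
    \<comment> \<open>On \<open>space M\<close> the point \<open>S n x\<close> lies in
      \<open>A\<close> exactly when \<open>x\<close> lies in \<open>E\<close>, and there
      \<open>f\<close> equals \<open>1 - prob E\<close>.\<close>
    also have "\<dots> = expectation (\<lambda>x. f x * indicator A (S n x))"
      using A(2) by (intro Bochner_Integration.integral_cong) (auto simp: f_def indicator_def)
    also have "\<dots> = expectation (\<lambda>x. Q n f x * indicator A x)"
      using A(1) by (intro perron_frobenius_operatorD(2)[OF Q int,
            where g = "indicat_real A" and C = 1, symmetric])
        (auto simp: indicator_def)
    also have "\<dots> \<le> expectation (\<lambda>x. \<bar>Q n f x\<bar>)"
      using A(1) Qf by (intro integral_mono integrable_real_mult_indicator)
        (auto simp: indicator_def)
    finally show ?thesis by (simp add: L1_norm_def)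
  qed
  \<comment> \<open>The lower bound does not depend on \<open>n\<close>, while the norms tend to 0;
    it need only hold from \<open>n = 1\<close> on.\<close>
  have "prob E * (1 - prob E) \<le> 0"
    using lim[OF int f0] le by (intro LIMSEQ_le_const[where X = "\<lambda>n. L1_norm M (Q n f)"]) auto
  moreover have "0 \<le> prob E * (1 - prob E)" by simp
  ultimately show ?thesis by simp
qed

lemma (in prob_space) perron_frobenius_tendsto_0_if_tail_trivial:
  assumes Q: "\<And>n. perron_frobenius_operator M (S n) (Q n)"
    and S: "\<And>n. S n \<in> M \<rightarrow>\<^sub>M M"
    and decr: "decseq (\<lambda>n. preimage_sets M (S n))"
    and triv: "\<And>A. (\<And>n. A \<in> preimage_sets M (S n)) \<Longrightarrow> prob A = 0 \<or> prob A = 1"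
    and f: "integrable M f" "expectation f = 0"
  shows "(\<lambda>n. L1_norm M (Q n f)) \<longlonglongrightarrow> 0"
proof -
  define F where "F n = vimage_algebra (space M) (S n) M" for n
  have sets_F: "sets (F n) = preimage_sets M (S n)" for n
    unfolding F_def by (rule sets_vimage_algebra_eq_preimage_sets[OF S])
  have sub: "subalgebra M (F n)" for n
    unfolding subalgebra_def sets_F
    using measurable_sets[OF S] by (auto simp: F_def preimage_sets_def)
  have "(\<lambda>n. expectation (\<lambda>x. \<bar>real_cond_exp M (F n) f x\<bar>)) \<longlonglongrightarrow> 0"
    using decr triv by (intro reverse_martingale_L1 sub f) (auto simp: sets_F decseq_def)
  then show ?thesis
  proof (rule Lim_null_comparison[rotated], intro always_eventually allI)
    fix n
    interpret sigma_finite_subalgebra M "F n"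
      by (intro finite_measure_subalgebra_is_sigma_finite finite_measure_subalgebra.intro
          finite_measure_axioms finite_measure_subalgebra_axioms.intro sub)
    \<comment> \<open>Pairing \<open>Q n f\<close> with its sign recovers its \<open>L^1\<close>
      norm, and duality moves the sign to \<open>?g (S n x)\<close>, which is measurable for
      \<open>F n\<close> because \<open>F n\<close> is generated by \<open>S n\<close>.\<close>
    let ?g = "\<lambda>x. sgn (Q n f x)"
    have Qf: "integrable M (Q n f)"
      by (rule perron_frobenius_operatorD(1)[OF Q f(1)])
    have g: "?g \<in> borel_measurable M" "\<bar>?g x\<bar> \<le> 1" for x
      using Qf by (auto simp: sgn_real_def)
    have "S n \<in> F n \<rightarrow>\<^sub>M M"
      unfolding F_def using measurable_space[OF S] by (intro measurable_vimage_algebra1) auto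
    then have gF: "(\<lambda>x. ?g (S n x)) \<in> borel_measurable (F n)"
      using g(1) by (rule measurable_compose)
    have "L1_norm M (Q n f) = expectation (\<lambda>x. Q n f x * ?g x)"
      by (simp add: L1_norm_def abs_sgn)
    also have "\<dots> = expectation (\<lambda>x. f x * ?g (S n x))"
      using g by (intro perron_frobenius_operatorD(2)[OF Q f(1), where g = ?g and C = 1]) auto
    also have "\<dots> \<le> expectation (\<lambda>x. \<bar>real_cond_exp M (F n) f x\<bar>)"
      by (rule integral_mult_le_cond_exp[OF f(1) gF g(2)])
    finally show "norm (L1_norm M (Q n f)) \<le> expectation (\<lambda>x. \<bar>real_cond_exp M (F n) f x\<bar>)"
      by (simp add: L1_norm_def)
  qed
qed

lemma (in prob_space) perron_frobenius_tendsto_0_iff_tail_trivial: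
  assumes Q: "\<And>n. perron_frobenius_operator M (S n) (Q n)"
    and S: "\<And>n. S n \<in> M \<rightarrow>\<^sub>M M"
    and decr: "decseq (\<lambda>n. preimage_sets M (S n))"
  shows "(\<forall>f. integrable M f \<and> expectation f = 0 \<longrightarrow> (\<lambda>n. L1_norm M (Q n f)) \<longlonglongrightarrow> 0)
    \<longleftrightarrow> eq_mod_null M (\<Inter>n\<in>{1..}. preimage_sets M (S n)) {{}, space M}"
proof -
  let ?\<T> = "\<Inter>n\<in>{1..}. preimage_sets M (S n)"
  have sub: "preimage_sets M (S n) \<subseteq> sets M" for n
    using measurable_sets[OF S] by (auto simp: preimage_sets_def)
  have ex: "{} \<in> preimage_sets M (S n)" "space M \<in> preimage_sets M (S n)" for n
    using sets.empty_sets[of "vimage_algebra (space M) (S n) M"]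
      sets.top[of "vimage_algebra (space M) (S n) M"]
    by (simp_all add: sets_vimage_algebra_eq_preimage_sets[OF S])
  have "?\<T> \<subseteq> sets M" using sub[of 1] by auto
  then have "eq_mod_null M ?\<T> {{}, space M} \<longleftrightarrow> (\<forall>A\<in>?\<T>. prob A = 0 \<or> prob A = 1)"
    using ex by (intro eq_mod_null_trivial_iff) auto
  moreover have "\<forall>A\<in>?\<T>. prob A = 0 \<or> prob A = 1"
    if "\<forall>f. integrable M f \<and> expectation f = 0 \<longrightarrow> (\<lambda>n. L1_norm M (Q n f)) \<longlonglongrightarrow> 0"
  proof
    fix A assume "A \<in> ?\<T>"
    then show "prob A = 0 \<or> prob A = 1"
      using that sub[of 1]
      by (intro prob_trivial_if_perron_frobenius_tendsto_0[OF Q]) auto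
  qed
  \<comment> \<open>The preceding lemma asks about sets in the preimage families for all
    \<open>n\<close>, including 0; such sets lie in \<open>?\<T>\<close>, whose index starts at
    1.\<close>
  moreover have "(\<lambda>n. L1_norm M (Q n f)) \<longlonglongrightarrow> 0"
    if "\<forall>A\<in>?\<T>. prob A = 0 \<or> prob A = 1" "integrable M f" "expectation f = 0" for f
    using that by (intro perron_frobenius_tendsto_0_if_tail_trivial[OF Q S decr]) auto
  ultimately show ?thesis by blast
qed

section \<open>Application along the orbits of the base map\<close>

theorem corollary3p2:
  fixes m :: "'a measure" and \<Omega> :: "'w measure"
    and \<sigma> :: "'w \<Rightarrow> 'w" and T :: "'w \<Rightarrow> 'a \<Rightarrow> 'a"
    and P :: "'w \<Rightarrow> ('a \<Rightarrow> real) \<Rightarrow> 'a \<Rightarrow> real"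
  assumes "prob_space m"
    and "prob_space \<Omega>"
    and "measure_preserving_map \<Omega> \<sigma>"
    and "markov_operator_cocycle m \<Omega> P \<sigma>"
    and "\<forall>\<omega>\<in>space \<Omega>. nonsingular_map m (T \<omega>)"
    and "\<forall>\<omega>\<in>space \<Omega>. perron_frobenius_operator m (T \<omega>) (P \<omega>)"
  shows "exact_cocycle m \<Omega> P \<sigma> \<longleftrightarrow>
    (AE \<omega> in \<Omega>. eq_mod_null m (\<Inter>n\<in>{1..}. preimage_sets m (cocycle_iter \<sigma> T n \<omega>)) {{}, space m})"
proof -
  interpret m: prob_space m by fact
  \<comment> \<open>The orbit stays in \<open>space \<Omega>\<close>, so the hypotheses on
    \<open>T\<close> and \<open>P\<close> hold at each of its points.\<close>
  have iter: "(\<sigma> ^^ k) \<omega> \<in> space \<Omega>" if "\<omega> \<in> space \<Omega>" for k \<omega>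
    using that assms(3)
    by (induction k) (auto simp: measure_preserving_map_def dest: measurable_space)
  have "(\<forall>f. integrable m f \<and> (LINT x|m. f x) = 0
        \<longrightarrow> (\<lambda>n. L1_norm m (cocycle_iter \<sigma> P n \<omega> f)) \<longlonglongrightarrow> 0)
      \<longleftrightarrow> eq_mod_null m (\<Inter>n\<in>{1..}. preimage_sets m (cocycle_iter \<sigma> T n \<omega>)) {{}, space m}"
    if "\<omega> \<in> space \<Omega>" for \<omega>
  proof -
    have ns: "nonsingular_map m (T ((\<sigma> ^^ k) \<omega>))" for k
      using iter[OF that] assms(5) by blast
    have pf: "perron_frobenius_operator m (T ((\<sigma> ^^ k) \<omega>)) (P ((\<sigma> ^^ k) \<omega>))" for k
      using iter[OF that] assms(6) by blast
    have T: "T ((\<sigma> ^^ k) \<omega>) \<in> m \<rightarrow>\<^sub>M m" for k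
      using ns by (simp add: nonsingular_map_def)
    have S: "cocycle_iter \<sigma> T n \<omega> \<in> m \<rightarrow>\<^sub>M m" for n
      by (rule cocycle_iter_measurable) (rule T)
    \<comment> \<open>Passing from \<open>n\<close> to \<open>Suc n\<close> composes with one more
      map on the left, which shrinks the preimage family.\<close>
    have "decseq (\<lambda>n. preimage_sets m (cocycle_iter \<sigma> T n \<omega>))"
      by (auto simp: decseq_Suc_iff dest: subsetD[OF preimage_sets_comp_subset[OF S T]])
    then show ?thesis
      by (intro m.perron_frobenius_tendsto_0_iff_tail_trivial
          cocycle_iter_perron_frobenius ns pf S)
  qed
  \<comment> \<open>The equivalence holds at every single point of \<open>space \<Omega>\<close>, so
    it passes to the almost everywhere statements.\<close>
  then show ?thesis
    unfolding exact_cocycle_def by (intro AE_cong)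
qed

end
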